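(* Let $f,g:\mathbb{R}^N\to\mathbb{R}\cup\{+\infty\}$, $F=f+g$ and $\mathcal{D}=\operatorname{int}(\operatorname{dom} f)$ satisfy assumptions (A1), (A2) of the context, and let $x^0\in\operatorname{dom} g$. Then the variable Bregman MM algorithm $x^{k+1}=\operatorname{argmin}_{x\in\mathbb{R}^N}\big(Q_f(x,x^k)+g(x)\big)$, $k\in\mathbb{N}$, is well defined (the minimizer exists and is unique at each iteration) and generates a sequence $(x^k)_{k\ge1}$ in $\operatorname{dom} g\subset\mathcal{D}$. Moreover, for every $k\in\mathbb{N}$ there exists $v^{k+1}\in\partial g(x^{k+1})$ such that $$x^{k+1}=\nabla h_{x^k}^{*}\big(\nabla h_{x^k}(x^k)-\nabla f(x^k)-v^{k+1}\big),$$ where $h^*$ denotes the Legendre–Fenchel conjugate of $h$.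
   Context: $\langle\cdot,\cdot\rangle$ and $\|\cdot\|$ are the Euclidean inner product and norm of $\mathbb{R}^N$; $\operatorname{dom} f=\{x: f(x)<+\infty\}$; $\Gamma_0(\mathbb{R}^N)$ is the set of proper lower semicontinuous convex functions $\mathbb{R}^N\to\mathbb{R}\cup\{+\infty\}$; $\partial g$ is the (convex) subdifferential of $g$. Legendre functions. $h\in\Gamma_0(\mathbb{R}^N)$ is essentially smooth if it is differentiable on $\operatorname{int}(\operatorname{dom} h)$ and $\|\nabla h(y^k)\|\to+\infty$ for every sequence $(y^k)$ in $\operatorname{int}(\operatorname{dom} h)$ converging to a boundary point of $\operatorname{dom} h$. It is Legendre if it is essentially smooth and strictly convex on $\operatorname{int}(\operatorname{dom} h)$. $\mathcal{L}(\mathbb{R}^N)$ is the set of Legendre functions. For $h\in\mathcal{L}(\mathbb{R}^N)$ and $(x,y)\in\operatorname{dom} h\times\operatorname{int}(\operatorname{dom} h)$, the Bregman distance is $D_h(x,y)=h(x)-h(y)-\langle\nabla h(y),x-y\rangle$. (A1) (a) $f:\mathbb{R}^N\to\mathbb{R}\cup\{+\infty\}$ is proper, $\mathcal{D}:=\operatorname{int}(\operatorname{dom} f)$ is nonempty and $f$ is continuously differentiable on $\mathcal{D}$. (b) $g:\mathbb{R}^N\to\mathbb{R}\cup\{+\infty\}$ is proper, lower semicontinuous, convex, with $\operatorname{dom} g\subset\mathcal{D}$. (c) $F=f+g$ is coercive, continuous on its domain, and bounded below by some $\underline{F}>-\infty$. (A2) There is a family $(h_z)_{z\in\mathcal{D}}$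 in $\mathcal{L}(\mathbb{R}^N)$ with $\mathcal{D}\subset\operatorname{int}(\operatorname{dom} h_z)$ for every $z\in\mathcal{D}$ such that, with $Q_f(x,z)=f(z)+\langle\nabla f(z),x-z\rangle+D_{h_z}(x,z)$, one has $f(x)\le Q_f(x,z)$ for all $x,z\in\mathcal{D}$. In the algorithm, the objective $Q_f(\cdot,x^k)+g$ is understood to be $+\infty$ outside $\operatorname{dom} g$. *)

theory Defs
  imports "HOL-Analysis.Analysis"
begin

section \<open>Extended-valued functions\<close>

text \<open>A function into the reals with plus infinity is an \<^typ>\<open>ereal\<close>-valued function that omits
  the value minus infinity; the latter is part of \<open>proper_fun\<close>.\<close>

definition edom :: "('a \<Rightarrow> ereal) \<Rightarrow> 'a set"
  where "edom f = {x. f x < \<infinity>}"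

definition proper_fun :: "('a \<Rightarrow> ereal) \<Rightarrow> bool"
  where "proper_fun f \<longleftrightarrow> (\<forall>x. f x \<noteq> - \<infinity>) \<and> edom f \<noteq> {}"

definition lsc_fun :: "('a::topological_space \<Rightarrow> ereal) \<Rightarrow> bool"
  where "lsc_fun f \<longleftrightarrow> (\<forall>x. f x \<le> Liminf (at x) f)"

definition convex_fun :: "('a::real_vector \<Rightarrow> ereal) \<Rightarrow> bool"
  where "convex_fun f \<longleftrightarrow>
    (\<forall>x y. \<forall>t::real. 0 < t \<and> t < 1 \<longrightarrow>
       f ((1 - t) *\<^sub>R x + t *\<^sub>R y) \<le> ereal (1 - t) * f x + ereal t * f y)"

definition strictly_convex_fun_on :: "'a::real_vector set \<Rightarrow> ('a \<Rightarrow> ereal) \<Rightarrow> bool"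
  where "strictly_convex_fun_on S f \<longleftrightarrow>
    (\<forall>x\<in>S. \<forall>y\<in>S. \<forall>t::real. x \<noteq> y \<and> 0 < t \<and> t < 1 \<longrightarrow>
       f ((1 - t) *\<^sub>R x + t *\<^sub>R y) < ereal (1 - t) * f x + ereal t * f y)"

definition Gamma0 :: "('a::euclidean_space \<Rightarrow> ereal) set"
  where "Gamma0 = {f. proper_fun f \<and> lsc_fun f \<and> convex_fun f}"

text \<open>The Frechet gradient: the function has to be finite near the point, so that
  \<^const>\<open>real_of_ereal\<close>, which sends both infinities to 0, does no harm.\<close>

definition has_gradient :: "('a::euclidean_space \<Rightarrow> ereal) \<Rightarrow> 'a \<Rightarrow> 'a \<Rightarrow> bool"
  where "has_gradient f x v \<longleftrightarrow>
    x \<in> interior {y. \<bar>f y\<bar> \<noteq> \<infinity>} \<and> GDERIV (\<lambda>y. real_of_ereal (f y)) x :> v"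

definition differentiable_fun_at :: "('a::euclidean_space \<Rightarrow> ereal) \<Rightarrow> 'a \<Rightarrow> bool"
  where "differentiable_fun_at f x \<longleftrightarrow> (\<exists>v. has_gradient f x v)"

definition gradient :: "('a::euclidean_space \<Rightarrow> ereal) \<Rightarrow> 'a \<Rightarrow> 'a"
  where "gradient f x = (THE v. has_gradient f x v)"

lemma gradient_eqI:
  assumes "has_gradient f x v"
  shows "gradient f x = v"
proof -
  have "w = v" if "has_gradient f x w" for w
  proof -
    have "(\<lambda>d. d \<bullet> w) = (\<lambda>d. d \<bullet> v)"
      using assms that unfolding has_gradient_def gderiv_def
      by (blast intro: has_derivative_unique)
    then have "(w - v) \<bullet> w = (w - v) \<bullet> v"
      by meson
    then show ?thesis
      by (metis eq_iff_diff_eq_0 inner_diff_right inner_eq_zero_iff)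
  qed
  with assms show ?thesis
    unfolding gradient_def by blast
qed

definition subdifferential :: "('a::euclidean_space \<Rightarrow> ereal) \<Rightarrow> 'a \<Rightarrow> 'a set"
  where "subdifferential g x = {v. \<forall>y. g x + ereal (v \<bullet> (y - x)) \<le> g y}"

definition fenchel_conjugate :: "('a::euclidean_space \<Rightarrow> ereal) \<Rightarrow> 'a \<Rightarrow> ereal"
  where "fenchel_conjugate h u = (SUP x. ereal (u \<bullet> x) - h x)"

section \<open>Legendre functions and Bregman distances\<close>

definition essentially_smooth :: "('a::euclidean_space \<Rightarrow> ereal) \<Rightarrow> bool"
  where "essentially_smooth h \<longleftrightarrow>
    (\<forall>x\<in>interior (edom h). differentiable_fun_at h x) \<and>
    (\<forall>y b. (\<forall>k::nat. y k \<in> interior (edom h)) \<and> b \<in> frontier (edom h) \<and> y \<longlonglongrightarrow> b \<longrightarrow>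
       filterlim (\<lambda>k. norm (gradient h (y k))) at_top sequentially)"

definition Legendre_funs :: "('a::euclidean_space \<Rightarrow> ereal) set"
  where "Legendre_funs =
    {h \<in> Gamma0. essentially_smooth h \<and> strictly_convex_fun_on (interior (edom h)) h}"

text \<open>Meant for \<open>x\<close> in the domain of \<open>h\<close> and \<open>y\<close> in its interior; for such \<open>y\<close> and all other \<open>x\<close>
  (if \<open>h\<close> is proper) its value is plus infinity.\<close>

definition bregman :: "('a::euclidean_space \<Rightarrow> ereal) \<Rightarrow> 'a \<Rightarrow> 'a \<Rightarrow> ereal"
  where "bregman h x y = h x - h y - ereal (gradient h y \<bullet> (x - y))"

section \<open>The variable Bregman majorization-minimization algorithm\<close>

definition majorant ::
    "('a::euclidean_space \<Rightarrow> ereal) \<Rightarrow> ('a \<Rightarrow> 'a \<Rightarrow> ereal) \<Rightarrow> 'a \<Rightarrow> 'a \<Rightarrow> ereal"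
  where "majorant f h x z = f z + ereal (gradient f z \<bullet> (x - z)) + bregman (h z) x z"

definition mm_objective ::
    "('a::euclidean_space \<Rightarrow> ereal) \<Rightarrow> ('a \<Rightarrow> ereal) \<Rightarrow> ('a \<Rightarrow> 'a \<Rightarrow> ereal) \<Rightarrow> 'a \<Rightarrow> 'a \<Rightarrow> ereal"
  where "mm_objective f g h z x = (if x \<in> edom g then majorant f h x z + g x else \<infinity>)"

text \<open>\<^const>\<open>arg_min\<close> picks an arbitrary minimizer, and an arbitrary point if there is none, so
  these iterates are meaningful only once each minimizer is known to exist and to be unique.\<close>

primrec mm_iterate ::
    "('a::euclidean_space \<Rightarrow> ereal) \<Rightarrow> ('a \<Rightarrow> ereal) \<Rightarrow> ('a \<Rightarrow> 'a \<Rightarrow> ereal) \<Rightarrow> 'a \<Rightarrow> nat \<Rightarrow> 'a"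
  where
    "mm_iterate f g h x0 0 = x0"
  | "mm_iterate f g h x0 (Suc k) = arg_min (mm_objective f g h (mm_iterate f g h x0 k)) (\<lambda>_. True)"

section \<open>Standing assumptions\<close>

definition assumption_A1 ::
    "('a::euclidean_space \<Rightarrow> ereal) \<Rightarrow> ('a \<Rightarrow> ereal) \<Rightarrow> bool"
  where "assumption_A1 f g \<longleftrightarrow>
    (proper_fun f \<and> interior (edom f) \<noteq> {} \<and>
       (\<forall>x\<in>interior (edom f). differentiable_fun_at f x) \<and>
       continuous_on (interior (edom f)) (gradient f)) \<and>
    (proper_fun g \<and> lsc_fun g \<and> convex_fun g \<and> edom g \<subseteq> interior (edom f)) \<and>
    (let F = (\<lambda>x. f x + g x) in
       (F \<longlongrightarrow> \<infinity>) at_infinity \<and> continuous_on (edom F) F \<and> (\<exists>m::real. \<forall>x. ereal m \<le> F x))"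

definition assumption_A2 ::
    "('a::euclidean_space \<Rightarrow> ereal) \<Rightarrow> ('a \<Rightarrow> 'a \<Rightarrow> ereal) \<Rightarrow> bool"
  where "assumption_A2 f h \<longleftrightarrow>
    (\<forall>z\<in>interior (edom f). h z \<in> Legendre_funs \<and> interior (edom f) \<subseteq> interior (edom (h z))) \<and>
    (\<forall>x\<in>interior (edom f). \<forall>z\<in>interior (edom f). f x \<le> majorant f h x z)"

end

theory Submission
  imports Defs
begin

text \<open>On \<open>dom g\<close> the objective equals \<open>h\<^sub>z + g\<close> plus an affine function. It dominates \<open>F\<close>, hence is
  coercive, and lower semicontinuity and strict convexity give a unique minimizer \<open>y\<close>. As \<open>dom g\<close>
  lies in the interior of \<open>dom h\<^sub>z\<close>, the function \<open>h\<^sub>z\<close> is differentiable at \<open>y\<close>, so optimality along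
  segments yields \<open>v \<in> \<partial>g(y)\<close> with \<open>\<nabla>h\<^sub>z(y) = \<nabla>h\<^sub>z(z) - \<nabla>f(z) - v\<close>, with no subdifferential sum rule.
  Finally, \<open>h\<^sub>z\<^sup>*\<close> has gradient \<open>y\<close> at \<open>u = \<nabla>h\<^sub>z(y)\<close>: strict convexity makes the gap between \<open>h\<^sub>z\<close> and its
  tangent at \<open>y\<close> grow at least linearly away from any small ball around \<open>y\<close>, which confines the
  supremum defining \<open>h\<^sub>z\<^sup>*(u + w)\<close> to that ball as soon as \<open>w\<close> is small.\<close>

section \<open>Convexity and lower semicontinuity of extended-valued functions\<close>

lemma convex_funD:
  assumes "convex_fun f" and "0 < t" and "t < 1"
  shows "f ((1 - t) *\<^sub>R x + t *\<^sub>R y) \<le> ereal (1 - t) * f x + ereal t * f y"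
  using assms unfolding convex_fun_def by blast

lemma strictly_convex_fun_onD:
  assumes "strictly_convex_fun_on S f" and "x \<in> S" and "y \<in> S" and "x \<noteq> y" and "0 < t" and "t < 1"
  shows "f ((1 - t) *\<^sub>R x + t *\<^sub>R y) < ereal (1 - t) * f x + ereal t * f y"
  using assms unfolding strictly_convex_fun_on_def by blast

lemma lsc_fun_iff: "lsc_fun f \<longleftrightarrow> (\<forall>x. \<forall>c < f x. \<forall>\<^sub>F y in at x. c < f y)"
  unfolding lsc_fun_def by (simp add: le_Liminf_iff)

lemma lsc_fun_open_superlevel:
  assumes "lsc_fun f"
  shows "open {x. c < f x}"
proof (rule topological_space_class.openI)
  fix x assume "x \<in> {x. c < f x}"
  \<comment> \<open>\<open>lsc_fun\<close> controls only punctured neighbourhoods; the assumption at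
    \<open>x\<close> itself fills in the centre.\<close>
  with assms have "\<forall>\<^sub>F y in nhds x. c < f y"
    unfolding lsc_fun_iff by (auto simp: eventually_nhds_conv_at)
  then show "\<exists>T. open T \<and> x \<in> T \<and> T \<subseteq> {x. c < f x}"
    unfolding eventually_nhds by blast
qed

text \<open>If no point of \<open>S\<close> were a minimizer, the open sets
  \<open>{x. f y < f x}\<close> with \<open>y \<in> S\<close> would cover \<open>S\<close>. A finite
  subcover misses the index at which \<open>f\<close> is smallest.\<close>

lemma lsc_fun_attains_min:
  assumes "lsc_fun f" and "compact S" and "S \<noteq> {}"
  obtains y where "y \<in> S" and "\<And>x. x \<in> S \<Longrightarrow> f y \<le> f x"
proof -
  have "\<exists>y\<in>S. \<forall>x\<in>S. f y \<le> f x"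
  proof (rule ccontr)
    assume "\<not> ?thesis"
    then have "S \<subseteq> (\<Union>y\<in>S. {x. f y < f x})"
      by (auto simp: not_le)
    from compactE_image[OF \<open>compact S\<close> lsc_fun_open_superlevel[OF \<open>lsc_fun f\<close>] this]
    obtain C where C: "C \<subseteq> S" "finite C" "S \<subseteq> (\<Union>y\<in>C. {x. f y < f x})"
      by metis
    with \<open>S \<noteq> {}\<close> have "C \<noteq> {}"
      by auto
    then have "Min (f ` C) \<in> f ` C"
      using C(2) by simp
    then obtain m where m: "m \<in> C" "f m = Min (f ` C)"
      by auto
    then obtain y where "y \<in> C" "f y < f m"
      using C(1,3) by blast
    then show False
      using m C(2) by (metis Min_le finite_imageI image_eqI not_le)
  qed
  with that show ?thesis
    by blast
qed

lemma ereal_less_add_obtains_reals: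
  fixes c u v :: ereal
  assumes "c < u + v" and "u \<noteq> -\<infinity>" and "v \<noteq> -\<infinity>"
  obtains a b :: real where "ereal a < u" and "ereal b < v" and "c \<le> ereal (a + b)"
proof -
  have unbounded: "\<exists>a::real. ereal a < w" if "w \<noteq> -\<infinity>" for w
    using that by (cases w) (auto intro: lt_ex)
  show ?thesis
  proof (cases c)
    case (real r)
    show ?thesis
    proof (cases u)
      case u: (real ru)
      show ?thesis
      proof (cases v)
        case v: (real rv)
        \<comment> \<open>Half of the slack goes to each summand, so the two bounds add up to
          exactly \<open>r\<close>.\<close>
        define d where "d = (ru + rv - r) / 2"
        have "d > 0"
          using assms(1) u v real by (simp add: d_def)
        then show ?thesis
          using that[of "ru - d" "rv - d"] u v real by (simp add: d_def field_simps)
      next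
        case PInf
        then show ?thesis
          using that[of "ru - 1" "r - ru + 1"] u real by simp
      qed (use assms in auto)
    next
      case PInf
      obtain b where "ereal b < v"
        using unbounded assms(3) by blast
      with PInf show ?thesis
        using that[of "r - b" b] real by simp
    qed (use assms in auto)
  next
    case MInf
    with that unbounded assms(2,3) show ?thesis
      by (metis ereal_less_eq(2))
  qed (use assms in auto)
qed

lemma lsc_fun_add:
  assumes f: "lsc_fun f" and g: "lsc_fun g"
    and "\<And>x. f x \<noteq> -\<infinity>" and "\<And>x. g x \<noteq> -\<infinity>"
  shows "lsc_fun (\<lambda>x. f x + g x)"
  unfolding lsc_fun_iff
proof (intro allI impI)
  fix x c assume "c < f x + g x"
  then obtain a b :: real where ab: "ereal a < f x" "ereal b < g x" "c \<le> ereal (a + b)"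
    using assms(3,4) ereal_less_add_obtains_reals by metis
  have "\<forall>\<^sub>F y in at x. ereal a < f y" and "\<forall>\<^sub>F y in at x. ereal b < g y"
    using f g ab unfolding lsc_fun_iff by blast+
  then show "\<forall>\<^sub>F y in at x. c < f y + g y"
  proof eventually_elim
    case (elim y)
    then have "ereal a + ereal b < f y + g y"
      by (rule ereal_add_strict_mono2)
    with ab(3) show ?case
      by simp
  qed
qed

lemma lsc_fun_affine:
  fixes a :: "'a::real_inner"
  shows "lsc_fun (\<lambda>x. ereal (a \<bullet> x + b))"
  unfolding lsc_fun_iff
proof (intro allI impI)
  fix x c assume "c < ereal (a \<bullet> x + b)"
  moreover have "((\<lambda>x. ereal (a \<bullet> x + b)) \<longlongrightarrow> ereal (a \<bullet> x + b)) (at x)"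
    by (intro tendsto_intros)
  ultimately show "\<forall>\<^sub>F y in at x. c < ereal (a \<bullet> y + b)"
    by (rule order_tendstoD(1)[rotated])
qed

section \<open>Gradients, subgradients and first-order optimality\<close>

text \<open>A smooth function \<open>s\<close>, shifted to touch \<open>g\<close> from below at
  \<open>x\<close>, passes its gradient to \<open>g\<close>: along the segment towards
  \<open>y\<close> its difference quotients tend to \<open>v \<bullet> (y - x)\<close>, while
  convexity of \<open>g\<close> bounds them by \<open>g y - g x\<close>. Taking for \<open>s\<close>
  the convex function itself gives the gradient inequality; taking minus the smooth part of a sum
  gives the optimality condition.\<close>

lemma gradient_of_minorant_in_subdifferential:
  fixes g :: "'a::euclidean_space \<Rightarrow> ereal"
  assumes g: "convex_fun g" "\<And>y. g y \<noteq> -\<infinity>" "g x = ereal c"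
    and s: "GDERIV s x :> v"
    and minorant: "\<forall>\<^sub>F y in nhds x. ereal (c + (s y - s x)) \<le> g y"
  shows "v \<in> subdifferential g x"
  unfolding subdifferential_def mem_Collect_eq
proof
  fix y
  show "g x + ereal (v \<bullet> (y - x)) \<le> g y"
  proof (cases "g y")
    case (real d)
    define w where "w t = x + t *\<^sub>R (y - x)" for t
    have w0: "w 0 = x"
      by (simp add: w_def)
    have "(w has_derivative (\<lambda>t. t *\<^sub>R (y - x))) (at 0)"
      unfolding w_def by (auto intro!: derivative_eq_intros)
    moreover have "(s has_derivative (\<lambda>h. h \<bullet> v)) (at (w 0))"
      using s by (simp add: gderiv_def w0)
    ultimately have "((\<lambda>t. s (w t)) has_derivative (\<lambda>t. (t *\<^sub>R (y - x)) \<bullet> v)) (at 0)"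
      by (rule has_derivative_compose)
    then have "((\<lambda>t. s (w t)) has_real_derivative v \<bullet> (y - x)) (at 0)"
      by (simp add: has_field_derivative_def inner_commute mult_commute_abs)
    then have "((\<lambda>t. (s (w t) - s x) / t) \<longlongrightarrow> v \<bullet> (y - x)) (at 0)"
      by (simp add: DERIV_def w0)
    \<comment> \<open>Only \<open>t > 0\<close> is of use: the convexity inequality lives on the
      segment, and dividing by \<open>t\<close> must keep its direction.\<close>
    then have lim: "((\<lambda>t. (s (w t) - s x) / t) \<longlongrightarrow> v \<bullet> (y - x)) (at_right 0)"
      by (rule filterlim_at_split[THEN iffD1, THEN conjunct2])
    have "isCont w 0"
      unfolding w_def by simp
    then have "filterlim w (nhds x) (at_right 0)"
      by (metis w0 isCont_def filterlim_at_split)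
    with minorant have "\<forall>\<^sub>F t in at_right 0. ereal (c + (s (w t) - s x)) \<le> g (w t)"
      unfolding filterlim_iff by blast
    moreover have "\<forall>\<^sub>F t in at_right (0::real). 0 < t \<and> t < 1"
      using eventually_at_right_real[of 0 1] by simp
    ultimately have "\<forall>\<^sub>F t in at_right 0. (s (w t) - s x) / t \<le> d - c"
    proof eventually_elim
      case (elim t)
      have "w t = (1 - t) *\<^sub>R x + t *\<^sub>R y"
        by (simp add: w_def algebra_simps)
      with g(1) elim(2) have "g (w t) \<le> ereal (1 - t) * g x + ereal t * g y"
        by (metis convex_funD)
      with elim(1) have "ereal (c + (s (w t) - s x)) \<le> ereal (1 - t) * g x + ereal t * g y"
        by (rule order_trans)
      then show ?case
        using elim(2) by (simp add: g(3) real field_simps)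
    qed
    then have "v \<bullet> (y - x) \<le> d - c"
      by (rule tendsto_upperbound[OF lim]) simp
    then show ?thesis
      by (simp add: g(3) real)
  qed (use g(2) in auto)
qed

lemma has_gradient_eventually_finite:
  assumes "has_gradient f x v"
  shows "\<forall>\<^sub>F y in nhds x. \<bar>f y\<bar> \<noteq> \<infinity>"
proof -
  have "\<forall>\<^sub>F y in nhds x. y \<in> interior {y. \<bar>f y\<bar> \<noteq> \<infinity>}"
    using assms by (intro eventually_nhds_in_open) (simp_all add: has_gradient_def)
  then show ?thesis
    by (rule eventually_mono) (auto dest: interior_subset[THEN subsetD])
qed

lemma has_gradient_finite: "has_gradient f x v \<Longrightarrow> \<bar>f x\<bar> \<noteq> \<infinity>"
  using has_gradient_eventually_finite by (rule eventually_nhds_x_imp_x)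

lemma gradient_in_subdifferential:
  fixes f :: "'a::euclidean_space \<Rightarrow> ereal"
  assumes "convex_fun f" and "\<And>y. f y \<noteq> -\<infinity>" and "has_gradient f x v"
  shows "v \<in> subdifferential f x"
proof (rule gradient_of_minorant_in_subdifferential)
  show "f x = ereal (real_of_ereal (f x))"
    using has_gradient_finite[OF assms(3)] by (simp add: ereal_real)
  show "GDERIV (\<lambda>y. real_of_ereal (f y)) x :> v"
    using assms(3) by (simp add: has_gradient_def)
  have "\<forall>\<^sub>F y in nhds x. \<bar>f y\<bar> \<noteq> \<infinity>"
    using assms(3) by (rule has_gradient_eventually_finite)
  then show "\<forall>\<^sub>F y in nhds x. ereal (real_of_ereal (f x) +
      (real_of_ereal (f y) - real_of_ereal (f x))) \<le> f y"
    by eventually_elim (simp add: ereal_real)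
qed (use assms in auto)

text \<open>Rearranged, minimality says that \<open>- s\<close>, shifted by a constant, lies below
  \<open>g\<close> near \<open>x\<close> and touches it at \<open>x\<close>.\<close>

lemma subgradient_of_minimizer_of_sum:
  fixes g s :: "'a::euclidean_space \<Rightarrow> ereal"
  assumes g: "convex_fun g" "\<And>y. g y \<noteq> -\<infinity>" "\<bar>g x\<bar> \<noteq> \<infinity>"
    and s: "has_gradient s x v"
    and min: "\<And>y. s x + g x \<le> s y + g y"
  shows "- v \<in> subdifferential g x"
proof (rule gradient_of_minorant_in_subdifferential)
  show "g x = ereal (real_of_ereal (g x))"
    using g(3) by (simp add: ereal_real)
  show "GDERIV (\<lambda>y. - real_of_ereal (s y)) x :> - v"
    using s by (intro GDERIV_minus) (simp add: has_gradient_def)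
  have "\<forall>\<^sub>F y in nhds x. \<bar>s y\<bar> \<noteq> \<infinity>"
    using s by (rule has_gradient_eventually_finite)
  then show "\<forall>\<^sub>F y in nhds x. ereal (real_of_ereal (g x) +
      (- real_of_ereal (s y) - - real_of_ereal (s x))) \<le> g y"
  proof eventually_elim
    case (elim y)
    then show ?case
      using min[of y] g(2)[of y] g(3) has_gradient_finite[OF s]
      by (cases "s y"; cases "s x"; cases "g x"; cases "g y") auto
  qed
qed (use g in auto)

section \<open>Strict convexity and differentiability of the conjugate\<close>

text \<open>By strict convexity \<open>H\<close> exceeds its tangent at \<open>p\<close> by a positive amount on the sphere of radius
  \<open>r\<close>, and convexity along rays from \<open>p\<close> propagates this gap linearly.\<close>

lemma strictly_convex_linear_growth:
  fixes H :: "'a::euclidean_space \<Rightarrow> ereal"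
  assumes H: "proper_fun H" "lsc_fun H" "convex_fun H"
    and strict: "strictly_convex_fun_on (interior (edom H)) H"
    and u: "has_gradient H p u" and Hp: "H p = ereal c"
    and r: "r > 0" "cball p r \<subseteq> interior (edom H)"
  obtains d where "d > 0"
    and "\<And>x. r \<le> norm (x - p) \<Longrightarrow> ereal (c + u \<bullet> (x - p) + d * norm (x - p)) \<le> H x"
proof -
  have ninf: "H x \<noteq> -\<infinity>" for x
    using H(1) by (simp add: proper_fun_def)
  have tangent: "ereal (c + u \<bullet> (x - p)) \<le> H x" for x
    using gradient_in_subdifferential[OF H(3) ninf u] by (simp add: subdifferential_def Hp)
  \<comment> \<open>\<open>G\<close> is the gap between \<open>H\<close> and its tangent at
    \<open>p\<close>; an affine shift preserves lower semicontinuity, so the gap has a minimum on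
    the sphere.\<close>
  define G where "G x = H x + ereal ((- u) \<bullet> x + (u \<bullet> p - c))" for x
  have "lsc_fun G"
    unfolding G_def by (intro lsc_fun_add lsc_fun_affine H ninf) simp
  moreover have "sphere p r \<noteq> {}" "compact (sphere p r)"
    using r(1) by simp_all
  ultimately obtain q where q: "q \<in> sphere p r" and qmin: "\<And>x. x \<in> sphere p r \<Longrightarrow> G q \<le> G x"
    by (metis lsc_fun_attains_min)
  have qp: "q \<noteq> p" "q \<in> interior (edom H)" "p \<in> interior (edom H)"
    using q r by auto
  then have "H q < \<infinity>"
    using interior_subset by (fastforce simp: edom_def)
  with ninf obtain b where b: "H q = ereal b"
    by (metis ereal_cases less_irrefl)
  \<comment> \<open>The least gap on the sphere, \<open>G q\<close>.\<close>
  define m where "m = b - c - u \<bullet> (q - p)"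
  have "H ((1 - 1/2) *\<^sub>R p + (1/2) *\<^sub>R q) < ereal (1 - 1/2) * H p + ereal (1/2) * H q"
    using strict qp by (intro strictly_convex_fun_onD) auto
  \<comment> \<open>At the midpoint of \<open>p\<close> and \<open>q\<close> the gap is nonnegative,
    yet strictly less than half of \<open>m\<close>.\<close>
  with tangent have "ereal (c + u \<bullet> (((1 - 1/2) *\<^sub>R p + (1/2) *\<^sub>R q) - p))
      < ereal (1 - 1/2) * H p + ereal (1/2) * H q"
    by (rule le_less_trans)
  then have "m > 0"
    by (simp add: Hp b m_def algebra_simps)
  have sphere: "ereal (c + u \<bullet> (x - p) + m) \<le> H x" if "x \<in> sphere p r" for x
    using qmin[OF that] b ninf[of x]
    by (cases "H x") (auto simp: G_def m_def algebra_simps)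
  have "ereal (c + u \<bullet> (x - p) + m / r * norm (x - p)) \<le> H x" if "r \<le> norm (x - p)" for x
  proof (cases "norm (x - p) = r")
    case True
    then show ?thesis
      using sphere[of x] r(1) by (simp add: dist_norm norm_minus_commute)
  next
    case False
    \<comment> \<open>This scaling puts the point \<open>y\<close> of the segment from
      \<open>p\<close> to \<open>x\<close> on the sphere.\<close>
    define t where "t = r / norm (x - p)"
    have "r < norm (x - p)"
      using False that by simp
    with r(1) have t: "0 < t" "t < 1" and tx: "t * norm (x - p) = r"
      unfolding t_def by (force intro: divide_pos_pos, force simp: divide_less_eq, force)
    define y where "y = (1 - t) *\<^sub>R p + t *\<^sub>R x"
    have yp: "y - p = t *\<^sub>R (x - p)"
      by (simp add: y_def algebra_simps)
    have "norm (y - p) = r"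
      using t tx by (simp add: yp)
    then have "ereal (c + u \<bullet> (y - p) + m) \<le> H y"
      by (intro sphere) (simp add: dist_norm norm_minus_commute)
    also have "H y \<le> ereal (1 - t) * H p + ereal t * H x"
      unfolding y_def using H(3) t by (rule convex_funD)
    finally have *: "ereal (c + u \<bullet> (y - p) + m) \<le> ereal (1 - t) * H p + ereal t * H x" .
    show ?thesis
    proof (cases "H x")
      case (real a)
      with * have "c + t * (u \<bullet> (x - p)) + m \<le> (1 - t) * c + t * a"
        by (simp add: Hp yp)
      then have "t * (c + u \<bullet> (x - p)) + m \<le> t * a"
        by (simp add: algebra_simps)
      moreover have "m = t * (m / r * norm (x - p))"
        using tx r(1) by (simp add: field_simps)
      ultimately have "t * (c + u \<bullet> (x - p) + m / r * norm (x - p)) \<le> t * a"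
        by (simp add: distrib_left)
      with t show ?thesis
        by (simp add: real)
    qed (use ninf in auto)
  qed
  moreover have "m / r > 0"
    using \<open>m > 0\<close> r(1) by simp
  ultimately show ?thesis
    using that by blast
qed

text \<open>The affine function \<open>v \<bullet> p - c\<close> bounds the conjugate from below
  and, up to an error \<open>e * norm (v - u)\<close>, also from above near \<open>u\<close>. As
  \<open>e\<close> is arbitrary, this is Frechet differentiability with gradient
  \<open>p\<close>.\<close>

lemma has_gradient_fenchel_conjugate:
  fixes H :: "'a::euclidean_space \<Rightarrow> ereal"
  assumes H: "proper_fun H" "lsc_fun H" "convex_fun H"
    and strict: "strictly_convex_fun_on (interior (edom H)) H"
    and p: "p \<in> interior (edom H)"
    and u: "has_gradient H p u"
  shows "has_gradient (fenchel_conjugate H) u p"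
proof -
  have ninf: "H x \<noteq> -\<infinity>" for x
    using H(1) by (simp add: proper_fun_def)
  obtain c where c: "H p = ereal c"
    using has_gradient_finite[OF u] by (cases "H p") auto
  have tangent: "ereal (c + u \<bullet> (x - p)) \<le> H x" for x
    using gradient_in_subdifferential[OF H(3) ninf u] by (simp add: subdifferential_def c)
  have lower: "ereal (v \<bullet> p - c) \<le> fenchel_conjugate H v" for v
    unfolding fenchel_conjugate_def by (rule SUP_upper2[of p]) (simp_all add: c)
  have upper: "\<exists>d>0. \<forall>v. norm (v - u) \<le> d \<longrightarrow>
      fenchel_conjugate H v \<le> ereal (v \<bullet> p - c + e * norm (v - u))" if "e > 0" for e
  proof -
    obtain e0 where e0: "e0 > 0" "cball p e0 \<subseteq> interior (edom H)"
      using p open_contains_cball[of "interior (edom H)"] by auto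
    \<comment> \<open>Radius at most \<open>e\<close> gives the desired error inside the ball;
      radius at most \<open>e0\<close> keeps the ball where strict convexity holds.\<close>
    define r where "r = min e e0"
    have r: "r > 0" "cball p r \<subseteq> interior (edom H)" "r \<le> e"
      using that e0 by (auto simp: r_def)
    obtain d where d: "d > 0" and
      growth: "\<And>x. r \<le> norm (x - p) \<Longrightarrow> ereal (c + u \<bullet> (x - p) + d * norm (x - p)) \<le> H x"
      using strictly_convex_linear_growth[OF H strict u c r(1,2)] by metis
    have "fenchel_conjugate H v \<le> ereal (v \<bullet> p - c + e * norm (v - u))"
      if v: "norm (v - u) \<le> d" for v
      unfolding fenchel_conjugate_def
    proof (rule SUP_least)
      fix x
      have cs: "(v - u) \<bullet> (x - p) \<le> norm (v - u) * norm (x - p)"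
        by (rule norm_cauchy_schwarz)
      have split: "v \<bullet> x - (c + u \<bullet> (x - p)) = v \<bullet> p - c + (v - u) \<bullet> (x - p)"
        by (simp add: algebra_simps)
      show "ereal (v \<bullet> x) - H x \<le> ereal (v \<bullet> p - c + e * norm (v - u))"
      proof (cases "H x")
        case (real a)
        have "v \<bullet> x - a \<le> v \<bullet> p - c + e * norm (v - u)"
        proof (cases "r \<le> norm (x - p)")
          \<comment> \<open>Away from \<open>p\<close>, the growth rate \<open>d\<close> absorbs the
            Cauchy-Schwarz term because \<open>norm (v - u) \<le> d\<close>.\<close>
          case True
          then have "c + u \<bullet> (x - p) + d * norm (x - p) \<le> a"
            using growth real by fastforce
          moreover have "norm (v - u) * norm (x - p) \<le> d * norm (x - p)"
            using v by (rule mult_right_mono) simp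
          moreover have "0 \<le> e * norm (v - u)"
            using \<open>e > 0\<close> by simp
          ultimately show ?thesis
            using cs split by linarith
        next
          \<comment> \<open>Close to \<open>p\<close>, the tangent bound suffices, since
            \<open>norm (x - p)\<close> is below \<open>e\<close>.\<close>
          case False
          have "c + u \<bullet> (x - p) \<le> a"
            using tangent[of x] real by simp
          moreover have "norm (v - u) * norm (x - p) \<le> norm (v - u) * e"
            using False r(3) by (intro mult_left_mono) auto
          ultimately show ?thesis
            using cs split by (simp add: mult.commute)
        qed
        then show ?thesis
          by (simp add: real)
      qed (use ninf in auto)
    qed
    with d show ?thesis
      by blast
  qed
  define C where "C v = real_of_ereal (fenchel_conjugate H v)" for v
  have real: "\<bar>fenchel_conjugate H v\<bar> \<noteq> \<infinity> \<and> v \<bullet> p - c \<le> C v \<and> C v \<le> b"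
    if "fenchel_conjugate H v \<le> ereal b" for v b
    using lower[of v] that by (cases "fenchel_conjugate H v") (auto simp: C_def)
  \<comment> \<open>Any positive error would do here; the aim is finiteness of the conjugate near
    \<open>u\<close>.\<close>
  obtain d where "d > 0" and d: "\<And>v. norm (v - u) \<le> d \<Longrightarrow>
      fenchel_conjugate H v \<le> ereal (v \<bullet> p - c + 1 * norm (v - u))"
    using upper[of 1] by auto
  have "ball u d \<subseteq> {v. \<bar>fenchel_conjugate H v\<bar> \<noteq> \<infinity>}"
  proof
    fix v assume "v \<in> ball u d"
    then have "norm (v - u) \<le> d"
      by (simp add: dist_norm norm_minus_commute)
    then show "v \<in> {v. \<bar>fenchel_conjugate H v\<bar> \<noteq> \<infinity>}"
      using real[OF d] by simp
  qed
  then have "u \<in> interior {v. \<bar>fenchel_conjugate H v\<bar> \<noteq> \<infinity>}"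
    using \<open>d > 0\<close> by (meson centre_in_ball interior_maximal open_ball subsetD)
  \<comment> \<open>At \<open>v = u\<close> the error term vanishes and the two bounds
    coincide.\<close>
  moreover have Cu: "C u = u \<bullet> p - c"
    using real[OF d[of u]] \<open>d > 0\<close> by simp
  have "GDERIV C u :> p"
    unfolding gderiv_def has_derivative_at_alt
  proof (intro conjI allI impI)
    show "bounded_linear (\<lambda>h. h \<bullet> p)"
      by (rule bounded_linear_inner_left)
    fix e :: real assume "e > 0"
    then obtain d where "d > 0" and d: "\<And>v. norm (v - u) \<le> d \<Longrightarrow>
        fenchel_conjugate H v \<le> ereal (v \<bullet> p - c + e * norm (v - u))"
      using upper by metis
    have "norm (C v - C u - (v - u) \<bullet> p) \<le> e * norm (v - u)" if "norm (v - u) < d" for v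
      using real[OF d[of v]] that Cu by (auto simp: algebra_simps)
    with \<open>d > 0\<close> show "\<exists>d>0. \<forall>v. norm (v - u) < d \<longrightarrow>
        norm (C v - C u - (v - u) \<bullet> p) \<le> e * norm (v - u)"
      by blast
  qed
  ultimately show ?thesis
    unfolding has_gradient_def C_def by blast
qed

section \<open>Affine perturbations and minimizers of sums\<close>

lemma convex_fun_add_affine:
  fixes g :: "'a::real_inner \<Rightarrow> ereal"
  assumes "convex_fun g" and "\<And>x. g x \<noteq> -\<infinity>"
  shows "convex_fun (\<lambda>x. g x + ereal (a \<bullet> x + b))"
  unfolding convex_fun_def
proof (intro allI impI)
  fix x y and t :: real assume t: "0 < t \<and> t < 1"
  have "g ((1 - t) *\<^sub>R x + t *\<^sub>R y) \<le> ereal (1 - t) * g x + ereal t * g y"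
    using assms(1) t by (blast intro: convex_funD)
  then show "g ((1 - t) *\<^sub>R x + t *\<^sub>R y) + ereal (a \<bullet> ((1 - t) *\<^sub>R x + t *\<^sub>R y) + b)
    \<le> ereal (1 - t) * (g x + ereal (a \<bullet> x + b)) + ereal t * (g y + ereal (a \<bullet> y + b))"
    using assms(2)[of x] assms(2)[of y] t
    by (cases "g x"; cases "g y"; cases "g ((1 - t) *\<^sub>R x + t *\<^sub>R y)")
      (auto simp: algebra_simps)
qed

lemma subdifferential_add_affine:
  fixes g :: "'a::euclidean_space \<Rightarrow> ereal"
  assumes "w \<in> subdifferential (\<lambda>x. g x + ereal (a \<bullet> x + b)) x"
  shows "w - a \<in> subdifferential g x"
  unfolding subdifferential_def mem_Collect_eq
proof
  fix y
  have "g x + ereal (a \<bullet> x + b) + ereal (w \<bullet> (y - x)) \<le> g y + ereal (a \<bullet> y + b)"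
    using assms by (simp add: subdifferential_def)
  then show "g x + ereal ((w - a) \<bullet> (y - x)) \<le> g y"
    by (cases "g x"; cases "g y") (auto simp: algebra_simps)
qed

text \<open>Existence: coercivity makes the sublevel set through a point of \<open>edom G\<close>
  compact. Uniqueness: minimizers have finite value, hence lie in \<open>S\<close>, where strict
  convexity of \<open>H\<close> lets the midpoint of two of them do better.\<close>

lemma ex1_minimizer_of_coercive_sum:
  fixes H G :: "'a::euclidean_space \<Rightarrow> ereal"
  assumes H: "H \<in> Gamma0" and strict: "strictly_convex_fun_on S H" and S: "S \<subseteq> edom H"
    and G: "G \<in> Gamma0" "edom G \<subseteq> S"
    and coercive: "((\<lambda>x. H x + G x) \<longlongrightarrow> \<infinity>) at_infinity"
  shows "\<exists>!y. is_arg_min (\<lambda>x. H x + G x) (\<lambda>_. True) y"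
proof -
  let ?P = "\<lambda>x. H x + G x"
  have Hn: "H x \<noteq> -\<infinity>" and Gn: "G x \<noteq> -\<infinity>" for x
    using H G by (auto simp: Gamma0_def proper_fun_def)
  obtain z where z: "z \<in> edom G"
    using G by (auto simp: Gamma0_def proper_fun_def)
  with S G have "z \<in> edom H"
    by blast
  with z have Pz: "?P z < \<infinity>"
    by (simp add: edom_def)
  have lsc: "lsc_fun ?P"
    using H G Hn Gn by (intro lsc_fun_add) (auto simp: Gamma0_def)
  define K where "K = {x. ?P x \<le> ?P z}"
  have "K = - {x. ?P z < ?P x}"
    by (auto simp: K_def not_less)
  then have "closed K"
    using lsc_fun_open_superlevel[OF lsc] by (simp add: closed_def)
  moreover have "\<forall>\<^sub>F x in at_infinity. ?P z < ?P x"
    using order_tendstoD(1)[OF coercive Pz] .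
  then obtain r where "\<And>x. r \<le> norm x \<Longrightarrow> ?P z < ?P x"
    unfolding eventually_at_infinity by blast
  then have "bounded K"
    unfolding bounded_iff K_def by (metis linorder_not_le mem_Collect_eq nle_le)
  ultimately have "compact K"
    by (simp add: compact_eq_bounded_closed)
  moreover have "z \<in> K"
    by (simp add: K_def)
  ultimately obtain y where y: "y \<in> K" "\<And>x. x \<in> K \<Longrightarrow> ?P y \<le> ?P x"
    using lsc_fun_attains_min[OF lsc, of K] by blast
  have "?P y \<le> ?P x" for x
  proof (cases "x \<in> K")
    case False
    then have "?P z \<le> ?P x"
      by (simp add: K_def)
    with y(2)[OF \<open>z \<in> K\<close>] show ?thesis
      by (rule order_trans)
  qed (use y in blast)
  then have "is_arg_min ?P (\<lambda>_. True) y"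
    by (simp add: is_arg_min_linorder)
  moreover have "y1 = y2"
    if "is_arg_min ?P (\<lambda>_. True) y1" and "is_arg_min ?P (\<lambda>_. True) y2" for y1 y2
  proof (rule ccontr)
    assume ne: "y1 \<noteq> y2"
    have min: "?P y1 \<le> ?P x" "?P y2 \<le> ?P x" for x
      using that by (auto simp: is_arg_min_linorder)
    then have fin: "?P y1 < \<infinity>" "?P y2 < \<infinity>"
      using Pz by (meson le_less_trans)+
    then have "y1 \<in> S" "y2 \<in> S"
      using Hn G(2) by (auto simp: edom_def)
    obtain a1 b1 where 1: "H y1 = ereal a1" "G y1 = ereal b1"
      using fin(1) Hn[of y1] Gn[of y1] by (cases "H y1"; cases "G y1") auto
    obtain a2 b2 where 2: "H y2 = ereal a2" "G y2 = ereal b2"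
      using fin(2) Hn[of y2] Gn[of y2] by (cases "H y2"; cases "G y2") auto
    define y where "y = (1 - 1/2) *\<^sub>R y1 + (1/2) *\<^sub>R y2"
    have "H y < ereal (1 - 1/2) * H y1 + ereal (1/2) * H y2"
      unfolding y_def using strict ne \<open>y1 \<in> S\<close> \<open>y2 \<in> S\<close> by (intro strictly_convex_fun_onD) auto
    then have "H y < ereal ((a1 + a2) / 2)"
      by (simp add: 1 2 field_simps)
    moreover have "G y \<le> ereal (1 - 1/2) * G y1 + ereal (1/2) * G y2"
      unfolding y_def using G by (intro convex_funD) (auto simp: Gamma0_def)
    then have "G y \<le> ereal ((b1 + b2) / 2)"
      by (simp add: 1 2 field_simps)
    moreover have "ereal (a1 + b1) \<le> H y + G y" "ereal (a2 + b2) \<le> H y + G y"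
      using min[of y] by (simp_all add: 1 2)
    ultimately show False
      by (cases "H y"; cases "G y") auto
  qed
  ultimately show ?thesis
    by blast
qed

section \<open>The objective of the algorithm and a single iteration\<close>

text \<open>The finite constants \<open>f z\<close> and \<open>h z z\<close> and the linear terms
  merge into one affine function, which is grouped with \<open>g\<close> to leave the kernel
  \<open>h z\<close> alone. Outside \<open>edom g\<close> both sides are infinite.\<close>

lemma mm_objective_decomposition:
  assumes "\<bar>f z\<bar> \<noteq> \<infinity>" and "\<bar>h z z\<bar> \<noteq> \<infinity>" and "\<And>x. h z x \<noteq> -\<infinity>"
  obtains b where "mm_objective f g h z =
    (\<lambda>x. h z x + (g x + ereal ((gradient f z - gradient (h z) z) \<bullet> x + b)))"
proof -
  obtain a where a: "f z = ereal a"
    using assms(1) by (cases "f z") auto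
  obtain c where c: "h z z = ereal c"
    using assms(2) by (cases "h z z") auto
  define b where "b = a - c - (gradient f z - gradient (h z) z) \<bullet> z"
  have "mm_objective f g h z x =
      h z x + (g x + ereal ((gradient f z - gradient (h z) z) \<bullet> x + b))" for x
    using assms(3)[of x]
    by (cases "h z x"; cases "g x")
      (auto simp: mm_objective_def majorant_def bregman_def edom_def a c b_def algebra_simps)
  with that show ?thesis
    by blast
qed

context
  fixes f g :: "'a::euclidean_space \<Rightarrow> ereal" and h :: "'a \<Rightarrow> 'a \<Rightarrow> ereal" and z :: 'a
  assumes A1: "assumption_A1 f g" and A2: "assumption_A2 f h" and z: "z \<in> edom g"
begin

lemma edom_g_subset: "edom g \<subseteq> interior (edom f)"
  using A1 by (simp add: assumption_A1_def)

lemma z_in_interior: "z \<in> interior (edom f)"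
  using edom_g_subset z by blast

lemma kernel_Legendre: "h z \<in> Legendre_funs"
  and edom_g_subset_kernel: "edom g \<subseteq> interior (edom (h z))"
  using A2 z_in_interior edom_g_subset by (auto simp: assumption_A2_def)

lemma mm_objective_as_sum:
  obtains b where "mm_objective f g h z =
    (\<lambda>x. h z x + (g x + ereal ((gradient f z - gradient (h z) z) \<bullet> x + b)))"
proof (rule mm_objective_decomposition)
  show "\<bar>f z\<bar> \<noteq> \<infinity>"
    using A1 z_in_interior has_gradient_finite
    by (metis assumption_A1_def differentiable_fun_at_def)
  show "h z x \<noteq> -\<infinity>" for x
    using kernel_Legendre by (simp add: Legendre_funs_def Gamma0_def proper_fun_def)
  then show "\<bar>h z z\<bar> \<noteq> \<infinity>"
    using edom_g_subset_kernel z interior_subset by (fastforce simp: edom_def)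
qed (rule that)

text \<open>The objective dominates the coercive function \<open>f + g\<close>: by majorization on
  \<open>edom g\<close>, and by being infinite elsewhere.\<close>

lemma mm_objective_coercive: "(mm_objective f g h z \<longlongrightarrow> \<infinity>) at_infinity"
proof -
  have "f x \<le> majorant f h x z" if "x \<in> edom g" for x
    using A2 z_in_interior edom_g_subset that unfolding assumption_A2_def by blast
  then have major: "f x + g x \<le> mm_objective f g h z x" for x
    by (simp add: mm_objective_def add_right_mono)
  have F: "((\<lambda>x. f x + g x) \<longlongrightarrow> \<infinity>) at_infinity"
    using A1 by (simp add: assumption_A1_def Let_def)
  show ?thesis
    unfolding tendsto_PInfty
  proof
    fix r
    have "\<forall>\<^sub>F x in at_infinity. ereal r < f x + g x"
      using F by (simp add: tendsto_PInfty)
    then show "\<forall>\<^sub>F x in at_infinity. ereal r < mm_objective f g h z x"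
      by eventually_elim (use major less_le_trans in blast)
  qed
qed

lemma mm_objective_ex1_minimizer: "\<exists>!y. is_arg_min (mm_objective f g h z) (\<lambda>_. True) y"
proof -
  obtain b where b: "mm_objective f g h z =
      (\<lambda>x. h z x + (g x + ereal ((gradient f z - gradient (h z) z) \<bullet> x + b)))"
    by (rule mm_objective_as_sum)
  define G where "G x = g x + ereal ((gradient f z - gradient (h z) z) \<bullet> x + b)" for x
  have g: "lsc_fun g" "convex_fun g" "\<And>x. g x \<noteq> -\<infinity>"
    using A1 by (auto simp: assumption_A1_def proper_fun_def)
  have dom: "edom G = edom g"
    by (auto simp: G_def edom_def)
  have "G x \<noteq> -\<infinity>" for x
    using g(3)[of x] by (simp add: G_def)
  moreover have "lsc_fun G"
    unfolding G_def using g by (intro lsc_fun_add lsc_fun_affine) auto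
  moreover have "convex_fun G"
    unfolding G_def using g by (intro convex_fun_add_affine)
  ultimately have "G \<in> Gamma0"
    using z dom by (auto simp: Gamma0_def proper_fun_def)
  moreover have "((\<lambda>x. h z x + G x) \<longlongrightarrow> \<infinity>) at_infinity"
    using mm_objective_coercive by (simp add: b G_def)
  ultimately have "\<exists>!y. is_arg_min (\<lambda>x. h z x + G x) (\<lambda>_. True) y"
    using kernel_Legendre edom_g_subset_kernel interior_subset dom
    by (intro ex1_minimizer_of_coercive_sum[where S = "interior (edom (h z))"])
      (auto simp: Legendre_funs_def)
  then show ?thesis
    by (simp add: b G_def)
qed

text \<open>The objective is finite at \<open>z\<close>, hence at any minimizer. This is the
  invariant that lets the next iteration start.\<close>

lemma mm_objective_minimizer_in_edom:
  assumes "is_arg_min (mm_objective f g h z) (\<lambda>_. True) y"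
  shows "y \<in> edom g"
proof (rule ccontr)
  assume "y \<notin> edom g"
  then have "mm_objective f g h z y = \<infinity>"
    by (simp add: mm_objective_def)
  then have "mm_objective f g h z z = \<infinity>"
    using assms by (metis ereal_infty_less_eq(1) is_arg_min_linorder)
  moreover obtain b where "mm_objective f g h z =
      (\<lambda>x. h z x + (g x + ereal ((gradient f z - gradient (h z) z) \<bullet> x + b)))"
    by (rule mm_objective_as_sum)
  moreover have "z \<in> edom (h z)"
    using edom_g_subset_kernel z interior_subset by blast
  ultimately show False
    using z by (simp add: edom_def)
qed

text \<open>With \<open>u\<close> the gradient of \<open>h z\<close> at \<open>y\<close>, optimality
  makes \<open>- u\<close> a subgradient of \<open>g\<close> plus the affine term. Removing the
  slope \<open>?a\<close> gives \<open>v = - u - ?a\<close>, for which the dual point is exactly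
  \<open>u\<close>, and there the conjugate has gradient \<open>y\<close>.\<close>

lemma mm_objective_minimizer_mirror_step:
  assumes y: "is_arg_min (mm_objective f g h z) (\<lambda>_. True) y"
  obtains v where "v \<in> subdifferential g y"
    and "has_gradient (fenchel_conjugate (h z)) (gradient (h z) z - gradient f z - v) y"
proof -
  let ?a = "gradient f z - gradient (h z) z"
  obtain b where b: "mm_objective f g h z = (\<lambda>x. h z x + (g x + ereal (?a \<bullet> x + b)))"
    by (rule mm_objective_as_sum)
  have g: "convex_fun g" "\<And>x. g x \<noteq> -\<infinity>"
    using A1 by (auto simp: assumption_A1_def proper_fun_def)
  have "y \<in> edom g"
    using y by (rule mm_objective_minimizer_in_edom)
  then have yH: "y \<in> interior (edom (h z))"
    using edom_g_subset_kernel by blast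
  then obtain u where u: "has_gradient (h z) y u"
    using kernel_Legendre
    by (auto simp: Legendre_funs_def essentially_smooth_def differentiable_fun_at_def)
  have "- u \<in> subdifferential (\<lambda>x. g x + ereal (?a \<bullet> x + b)) y"
  proof (rule subgradient_of_minimizer_of_sum[where s = "h z"])
    show "convex_fun (\<lambda>x. g x + ereal (?a \<bullet> x + b))"
      using g by (rule convex_fun_add_affine)
    show "g x + ereal (?a \<bullet> x + b) \<noteq> -\<infinity>" for x
      using g(2)[of x] by simp
    show "\<bar>g y + ereal (?a \<bullet> y + b)\<bar> \<noteq> \<infinity>"
      using g(2)[of y] \<open>y \<in> edom g\<close> by (cases "g y") (auto simp: edom_def)
    show "h z y + (g y + ereal (?a \<bullet> y + b)) \<le> h z x + (g x + ereal (?a \<bullet> x + b))" for x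
      using y by (simp add: b is_arg_min_linorder)
  qed (rule u)
  then have "- u - ?a \<in> subdifferential g y"
    by (rule subdifferential_add_affine)
  moreover have "has_gradient (fenchel_conjugate (h z)) u y"
    using kernel_Legendre yH u
    by (intro has_gradient_fenchel_conjugate) (auto simp: Legendre_funs_def Gamma0_def)
  moreover have "gradient (h z) z - gradient f z - (- u - ?a) = u"
    by simp
  ultimately show ?thesis
    using that by metis
qed

end

text \<open>Differentiability of the conjugate accompanies the update formula because
  \<open>gradient\<close> is a definite description, meaningful only where a gradient
  exists.\<close>

theorem proposition3p1:
  fixes f g :: "real ^ 'n \<Rightarrow> ereal"
    and h :: "real ^ 'n \<Rightarrow> real ^ 'n \<Rightarrow> ereal"
    and x0 :: "real ^ 'n"
    and x :: "nat \<Rightarrow> real ^ 'n"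
  assumes A1: "assumption_A1 f g"
    and A2: "assumption_A2 f h"
    and x0: "x0 \<in> edom g"
  defines "x \<equiv> mm_iterate f g h x0"
  shows "(\<forall>k. (\<exists>!y. is_arg_min (mm_objective f g h (x k)) (\<lambda>_. True) y) \<and>
              is_arg_min (mm_objective f g h (x k)) (\<lambda>_. True) (x (Suc k)))
       \<and> (\<forall>k\<ge>1. x k \<in> edom g) \<and> edom g \<subseteq> interior (edom f)
       \<and> (\<forall>k. \<exists>v \<in> subdifferential g (x (Suc k)).
              differentiable_fun_at (fenchel_conjugate (h (x k)))
                (gradient (h (x k)) (x k) - gradient f (x k) - v) \<and>
              x (Suc k) = gradient (fenchel_conjugate (h (x k)))
                (gradient (h (x k)) (x k) - gradient f (x k) - v))"
proof -
  have step: "is_arg_min (mm_objective f g h (x k)) (\<lambda>_. True) (x (Suc k))"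
    if "x k \<in> edom g" for k
    \<comment> \<open>\<open>arg_min\<close> is a choice operator; existence of a minimizer makes
      its choice a minimizer.\<close>
    using mm_objective_ex1_minimizer[OF A1 A2 that] by (auto simp: x_def arg_min_def intro: someI)
  \<comment> \<open>The induction starts at \<open>k = 0\<close>, as the first step already needs
    its starting point in \<open>edom g\<close>.\<close>
  have dom: "x k \<in> edom g" for k
  proof (induction k)
    case 0
    show ?case
      using x0 by (simp add: x_def)
  next
    case (Suc k)
    then show ?case
      using mm_objective_minimizer_in_edom[OF A1 A2] step by blast
  qed
  have "\<exists>v \<in> subdifferential g (x (Suc k)).
      differentiable_fun_at (fenchel_conjugate (h (x k)))
        (gradient (h (x k)) (x k) - gradient f (x k) - v) \<and>
      x (Suc k) = gradient (fenchel_conjugate (h (x k)))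
        (gradient (h (x k)) (x k) - gradient f (x k) - v)" for k
    using mm_objective_minimizer_mirror_step[OF A1 A2 dom step[OF dom]]
    unfolding differentiable_fun_at_def by (metis gradient_eqI)
  then show ?thesis
    using mm_objective_ex1_minimizer[OF A1 A2 dom] step[OF dom] dom edom_g_subset[OF A1 A2 x0]
    by (intro conjI allI impI)
qed

end
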